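(* Let $R$ be a ring, let $\sigma$ be a ring endomorphism of $R$ with $\sigma(1)=1$, $\sigma\neq 0$, $\sigma\neq\mathrm{id}_R$, and let $n$ be a positive integer. Let $(x^n)$ be the ideal of the polynomial ring $R[x]$ generated by $x^n$, and let $\bar\sigma$ be the endomorphism of $R[x]/(x^n)$ induced by $\sum a_i x^i\mapsto \sum\sigma(a_i)x^i$. If $R$ is $\sigma$-rigid, then $R[x]/(x^n)$ is strongly $\bar\sigma$-symmetric.
   Context: Rings are associative with identity, not necessarily commutative. For a ring $T$ and a ring endomorphism $\tau$ of $T$ with $\tau(1)=1$, the skew polynomial ring $T[y;\tau]$ consists of polynomials $\sum a_i y^i$ with $a_i\in T$, usual addition, and multiplication determined by $yr=\tau(r)y$ for $r\in T$. A ring is symmetric if $abc=0$ implies $acb=0$ for all elements $a,b,c$. $T$ is strongly $\tau$-symmetric if $T[y;\tau]$ is symmetric. $R$ is $\sigma$-rigid if $a\sigma(a)=0$ implies $a=0$ for all $a\in R$. In $R[x]$ the indeterminate $x$ commutes with the elements of $R$. *)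

theory Defs
  imports "HOL-Algebra.UnivPoly" "HOL-Algebra.QuotRing"
begin

locale symmetric_ring = ring R for R (structure) +
  assumes symmetric:
    "\<lbrakk>a \<in> carrier R; b \<in> carrier R; c \<in> carrier R; a \<otimes> b \<otimes> c = \<zero>\<rbrakk> \<Longrightarrow> a \<otimes> c \<otimes> b = \<zero>"

definition rigid :: "('a, 'm) ring_scheme \<Rightarrow> ('a \<Rightarrow> 'a) \<Rightarrow> bool" where
  "rigid R \<sigma> \<longleftrightarrow> (\<forall>a\<in>carrier R. a \<otimes>\<^bsub>R\<^esub> \<sigma> a = \<zero>\<^bsub>R\<^esub> \<longrightarrow> a = \<zero>\<^bsub>R\<^esub>)"

text \<open>
  The skew polynomial ring \<open>T[y;\<tau>]\<close>. As in \<^const>\<open>UP\<close>, \<open>\<Sum> a\<^sub>i y\<^sup>i\<close> is represented by its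
  finitely supported coefficient sequence; \<open>y r = \<tau>(r) y\<close> forces
  \<open>(a y\<^sup>i) (b y\<^sup>j) = a \<tau>\<^sup>i(b) y\<^sup>i\<^sup>+\<^sup>j\<close>.
\<close>

definition skew_poly :: "('a, 'm) ring_scheme \<Rightarrow> ('a \<Rightarrow> 'a) \<Rightarrow> (nat \<Rightarrow> 'a) ring" where
  "skew_poly T \<tau> = \<lparr>
     carrier = up T,
     mult = (\<lambda>p q k. \<Oplus>\<^bsub>T\<^esub>i\<in>{..k}. p i \<otimes>\<^bsub>T\<^esub> (\<tau> ^^ i) (q (k - i))),
     one = (\<lambda>i. if i = 0 then \<one>\<^bsub>T\<^esub> else \<zero>\<^bsub>T\<^esub>),
     zero = (\<lambda>i. \<zero>\<^bsub>T\<^esub>),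
     add = (\<lambda>p q i. p i \<oplus>\<^bsub>T\<^esub> q i)\<rparr>"

definition strongly_symmetric :: "('a, 'm) ring_scheme \<Rightarrow> ('a \<Rightarrow> 'a) \<Rightarrow> bool" where
  "strongly_symmetric T \<tau> \<longleftrightarrow> symmetric_ring (skew_poly T \<tau>)"

text \<open>\<^const>\<open>UP\<close> and \<^const>\<open>genideal\<close> (two-sided) do not need commutative coefficients.\<close>

definition x_power_ideal :: "('a, 'm) ring_scheme \<Rightarrow> nat \<Rightarrow> (nat \<Rightarrow> 'a) set" where
  "x_power_ideal R n = Idl\<^bsub>UP R\<^esub> {monom (UP R) \<one>\<^bsub>R\<^esub> 1 [^]\<^bsub>UP R\<^esub> n}"

definition trunc_poly :: "('a, 'm) ring_scheme \<Rightarrow> nat \<Rightarrow> (nat \<Rightarrow> 'a) set ring" where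
  "trunc_poly R n = UP R Quot x_power_ideal R n"

definition coeff_map :: "('a, 'm) ring_scheme \<Rightarrow> ('a \<Rightarrow> 'a) \<Rightarrow> (nat \<Rightarrow> 'a) \<Rightarrow> (nat \<Rightarrow> 'a)" where
  "coeff_map R \<sigma> p = (\<lambda>i. \<sigma> (coeff (UP R) p i))"

text \<open>
  The map on cosets induced by \<open>f\<close>. When \<open>f\<close> is an endomorphism with \<open>f(I) \<subseteq> I\<close>, all members
  of the union coincide; see \<open>quot_map_coset\<close> and \<open>induced_endo_coset\<close> below.
\<close>

definition quot_map :: "('a, 'm) ring_scheme \<Rightarrow> 'a set \<Rightarrow> ('a \<Rightarrow> 'a) \<Rightarrow> 'a set \<Rightarrow> 'a set" where
  "quot_map S I f C = (\<Union>p\<in>C. I +>\<^bsub>S\<^esub> f p)"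

definition induced_endo ::
    "('a, 'm) ring_scheme \<Rightarrow> nat \<Rightarrow> ('a \<Rightarrow> 'a) \<Rightarrow> (nat \<Rightarrow> 'a) set \<Rightarrow> (nat \<Rightarrow> 'a) set" where
  "induced_endo R n \<sigma> = quot_map (UP R) (x_power_ideal R n) (coeff_map R \<sigma>)"

lemma quot_map_coset:
  assumes "ideal I S" and f: "f \<in> ring_hom S S" and fI: "f ` I \<subseteq> I" and x: "x \<in> carrier S"
  shows "quot_map S I f (I +>\<^bsub>S\<^esub> x) = I +>\<^bsub>S\<^esub> f x"
proof -
  interpret ideal I S by fact
  have "I +>\<^bsub>S\<^esub> f p = I +>\<^bsub>S\<^esub> f x" if "p \<in> I +>\<^bsub>S\<^esub> x" for p
  proof -
    from that obtain h where h: "h \<in> I" "p = h \<oplus>\<^bsub>S\<^esub> x"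
      by (auto simp: a_r_coset_def')
    then have "f p = f h \<oplus>\<^bsub>S\<^esub> f x"
      using ring_hom_add[OF f] x a_Hcarr by blast
    moreover have "f h \<in> I" using fI h by auto
    ultimately have "f p \<in> I +>\<^bsub>S\<^esub> f x" by (auto simp: a_r_coset_def')
    then show ?thesis
      using a_repr_independence' ring_hom_closed[OF f x] by metis
  qed
  moreover have "x \<in> I +>\<^bsub>S\<^esub> x" using x by (rule a_rcos_self)
  ultimately show ?thesis unfolding quot_map_def by blast
qed

lemma coeff_map_hom:
  assumes "ring R" and \<sigma>: "\<sigma> \<in> ring_hom R R"
  shows "coeff_map R \<sigma> \<in> ring_hom (UP R) (UP R)"
proof -
  interpret R: ring R by fact
  interpret UP_ring R "UP R" by unfold_locales
  interpret \<sigma>: ring_hom_ring R R \<sigma>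
    by (rule ring_hom_ringI2[OF R.ring_axioms R.ring_axioms \<sigma>])
  have eq: "coeff_map R \<sigma> p = (\<lambda>i. \<sigma> (p i))" if "p \<in> up R" for p
    using that by (simp add: coeff_map_def UP_def)
  have cl: "(\<lambda>i. \<sigma> (p i)) \<in> up R" if p: "p \<in> up R" for p
  proof -
    obtain m where "bound \<zero>\<^bsub>R\<^esub> m p" using p by blast
    then have "bound \<zero>\<^bsub>R\<^esub> m (\<lambda>i. \<sigma> (p i))" by (auto simp: bound_def)
    then show ?thesis using mem_upD[OF p] by (intro mem_upI) auto
  qed
  show ?thesis
  proof (rule ring_hom_memI)
    fix p assume "p \<in> carrier (UP R)"
    then show "coeff_map R \<sigma> p \<in> carrier (UP R)"
      using eq cl by (simp add: UP_def)
  next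
    fix p q assume "p \<in> carrier (UP R)" "q \<in> carrier (UP R)"
    then have pq: "p \<in> up R" "q \<in> up R" by (simp_all add: UP_def)
    show "coeff_map R \<sigma> (p \<oplus>\<^bsub>UP R\<^esub> q) = coeff_map R \<sigma> p \<oplus>\<^bsub>UP R\<^esub> coeff_map R \<sigma> q"
      using pq mem_upD[OF pq(1)] mem_upD[OF pq(2)]
      by (simp add: eq cl R.up_add_closed UP_def coeff_map_def)
    have "\<sigma> (\<Oplus>\<^bsub>R\<^esub>i\<in>{..k}. p i \<otimes>\<^bsub>R\<^esub> q (k - i)) = (\<Oplus>\<^bsub>R\<^esub>i\<in>{..k}. \<sigma> (p i) \<otimes>\<^bsub>R\<^esub> \<sigma> (q (k - i)))" for k
    proof -
      have "\<sigma> (\<Oplus>\<^bsub>R\<^esub>i\<in>{..k}. p i \<otimes>\<^bsub>R\<^esub> q (k - i)) = (\<Oplus>\<^bsub>R\<^esub>i\<in>{..k}. (\<sigma> \<circ> (\<lambda>i. p i \<otimes>\<^bsub>R\<^esub> q (k - i))) i)"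
        using pq by (subst \<sigma>.hom_finsum) (auto dest: mem_upD simp: comp_def)
      also have "\<dots> = (\<Oplus>\<^bsub>R\<^esub>i\<in>{..k}. \<sigma> (p i) \<otimes>\<^bsub>R\<^esub> \<sigma> (q (k - i)))"
        by (rule R.finsum_cong') (use mem_upD[OF pq(1)] mem_upD[OF pq(2)] in auto)
      finally show ?thesis .
    qed
    then show "coeff_map R \<sigma> (p \<otimes>\<^bsub>UP R\<^esub> q) = coeff_map R \<sigma> p \<otimes>\<^bsub>UP R\<^esub> coeff_map R \<sigma> q"
      using pq by (simp add: eq cl R.up_mult_closed UP_def coeff_map_def)
  next
    show "coeff_map R \<sigma> \<one>\<^bsub>UP R\<^esub> = \<one>\<^bsub>UP R\<^esub>"
      using R.up_one_closed by (auto simp: coeff_map_def UP_def)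
  qed
qed

lemma x_power_ideal:
  assumes "ring R"
  shows "ideal (x_power_ideal R n) (UP R)"
proof -
  interpret R: ring R by fact
  interpret UP_ring R "UP R" by unfold_locales
  show ?thesis unfolding x_power_ideal_def by (rule P.genideal_ideal) simp
qed

lemma coeff_map_x_power_ideal:
  assumes "ring R" and \<sigma>: "\<sigma> \<in> ring_hom R R"
  shows "coeff_map R \<sigma> ` x_power_ideal R n \<subseteq> x_power_ideal R n"
proof -
  interpret R: ring R by fact
  interpret UP_ring R "UP R" by unfold_locales
  let ?x = "monom (UP R) \<one>\<^bsub>R\<^esub> 1"
  interpret I: ideal "x_power_ideal R n" "UP R" by (rule x_power_ideal) fact
  interpret f: ring_hom_ring "UP R" "UP R" "coeff_map R \<sigma>"
    by (rule ring_hom_ringI2[OF P.ring_axioms P.ring_axioms coeff_map_hom[OF R.ring_axioms \<sigma>]])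
  let ?J = "{p \<in> carrier (UP R). coeff_map R \<sigma> p \<in> x_power_ideal R n}"
  interpret \<sigma>: ring_hom_ring R R \<sigma>
    by (rule ring_hom_ringI2[OF R.ring_axioms R.ring_axioms \<sigma>])
  have "ideal ?J (UP R)"
  proof (rule idealI[OF P.ring_axioms])
    show "subgroup ?J (add_monoid (UP R))"
    proof (rule P.add.subgroupI)
      show "?J \<noteq> {}" using f.hom_zero I.zero_closed by auto
    next
      fix p assume "p \<in> ?J"
      then show "\<ominus>\<^bsub>UP R\<^esub> p \<in> ?J" using I.a_inv_closed by auto
    next
      fix p q assume "p \<in> ?J" "q \<in> ?J"
      then show "p \<oplus>\<^bsub>UP R\<^esub> q \<in> ?J" by (auto simp: I.a_closed)
    qed auto
  qed (auto intro: I.I_l_closed I.I_r_closed)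
  moreover have "coeff_map R \<sigma> ?x = ?x"
  proof -
    have "monom (UP R) \<one>\<^bsub>R\<^esub> 1 \<in> carrier (UP R)" by simp
    then show ?thesis by (auto simp: coeff_map_def UP_def)
  qed
  then have "coeff_map R \<sigma> (?x [^]\<^bsub>UP R\<^esub> n) = ?x [^]\<^bsub>UP R\<^esub> n"
    by (simp add: f.hom_nat_pow)
  then have "?x [^]\<^bsub>UP R\<^esub> n \<in> ?J"
    using P.genideal_self'[of "?x [^]\<^bsub>UP R\<^esub> n"] by (simp add: x_power_ideal_def)
  ultimately have "x_power_ideal R n \<subseteq> ?J"
    unfolding x_power_ideal_def by (intro P.genideal_minimal) auto
  then show ?thesis by auto
qed

lemma induced_endo_coset:
  assumes "ring R" "\<sigma> \<in> ring_hom R R" "p \<in> carrier (UP R)"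
  shows "induced_endo R n \<sigma> (x_power_ideal R n +>\<^bsub>UP R\<^esub> p)
    = x_power_ideal R n +>\<^bsub>UP R\<^esub> coeff_map R \<sigma> p"
  unfolding induced_endo_def
  by (rule quot_map_coset[OF x_power_ideal coeff_map_hom coeff_map_x_power_ideal]) fact+

end

theory Submission
  imports Defs
begin

text \<open>
  Since \<open>y\<close> commutes with \<open>x\<close>, the ring \<open>(R[x]/(x\<^sup>n))[y;\<tau>]\<close> is \<open>S[x]/(x\<^sup>n)\<close> for
  \<open>S = R[y;\<sigma>]\<close>. If \<open>R\<close> is \<open>\<sigma>\<close>-rigid, then \<open>S\<close> is reduced: \<open>a \<sigma>\<^sup>i(a) = 0\<close> forces
  \<open>a = 0\<close>, which kills the lowest coefficient of a square-zero element. Over a reduced ring, a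
  product \<open>f g h\<close> vanishes modulo \<open>x\<^sup>n\<close> only if \<open>f\<^sub>i g\<^sub>j h\<^sub>k = 0\<close> whenever
  \<open>i + j + k < n\<close>, and this condition is invariant under swapping \<open>g\<close> and \<open>h\<close> because
  reduced rings are symmetric.
\<close>

subsection \<open>Finite sums\<close>

lemma (in abelian_monoid) finsum_single:
  assumes "finite A" "i \<in> A" "f i \<in> carrier G" "\<And>j. j \<in> A \<Longrightarrow> j \<noteq> i \<Longrightarrow> f j = \<zero>"
  shows "finsum G f A = f i"
proof -
  have "finsum G f A = (\<Oplus>j\<in>A. if i = j then f i else \<zero>)"
    using assms by (intro finsum_cong') auto
  then show ?thesis using finsum_singleton[of i A "\<lambda>_. f i"] assms by simp
qed

text \<open>Both sides run over the pairs \<open>i \<le> j \<le> k\<close>; on the right,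
  \<open>j\<close> is replaced by its distance from \<open>i\<close>. This is the reindexing behind
  associativity of the skew product.\<close>

lemma (in abelian_monoid) finsum_triangle:
  fixes h :: "nat \<Rightarrow> nat \<Rightarrow> 'a"
  assumes [simp]: "\<And>i j. h i j \<in> carrier G"
  shows "(\<Oplus>j\<in>{..k}. \<Oplus>i\<in>{..j}. h i j) = (\<Oplus>i\<in>{..k}. \<Oplus>j\<in>{..k - i}. h i (i + j))"
proof (induction k)
  case (Suc k)
  have "(\<Oplus>i\<in>{..k}. \<Oplus>j\<in>{..Suc k - i}. h i (i + j))
      = (\<Oplus>i\<in>{..k}. h i (Suc k) \<oplus> (\<Oplus>j\<in>{..k - i}. h i (i + j)))"
    by (rule finsum_cong') (auto simp: Suc_diff_le)
  also have "\<dots> = (\<Oplus>i\<in>{..k}. h i (Suc k)) \<oplus> (\<Oplus>i\<in>{..k}. \<Oplus>j\<in>{..k - i}. h i (i + j))"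
    by (rule finsum_addf) auto
  finally show ?case by (simp add: Pi_def Suc.IH a_assoc)
qed simp

lemma (in abelian_monoid) finsum_swap:
  fixes h :: "nat \<Rightarrow> 'i \<Rightarrow> 'a"
  assumes [simp]: "\<And>i j. h i j \<in> carrier G"
  shows "(\<Oplus>i\<in>{..k}. \<Oplus>j\<in>B. h i j) = (\<Oplus>j\<in>B. \<Oplus>i\<in>{..k}. h i j)"
  by (induction k) (simp_all add: Pi_def)

subsection \<open>Reduced rings\<close>

locale reduced_ring = ring R for R (structure) +
  assumes reduced: "\<lbrakk>a \<in> carrier R; a \<otimes> a = \<zero>\<rbrakk> \<Longrightarrow> a = \<zero>"
begin

lemma mult_zero_commute:
  assumes [simp]: "a \<in> carrier R" "b \<in> carrier R" and "a \<otimes> b = \<zero>"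
  shows "b \<otimes> a = \<zero>"
proof -
  have "(b \<otimes> a) \<otimes> (b \<otimes> a) = b \<otimes> (a \<otimes> b) \<otimes> a" by (simp add: m_assoc)
  then show ?thesis using assms reduced[of "b \<otimes> a"] by simp
qed

text \<open>The square of \<open>a \<otimes> r \<otimes> b\<close> contains the factor
  \<open>b \<otimes> a\<close>, which vanishes because zero products commute in a reduced
  ring.\<close>

lemma mult_zero_insert:
  assumes [simp]: "a \<in> carrier R" "b \<in> carrier R" "r \<in> carrier R" and "a \<otimes> b = \<zero>"
  shows "a \<otimes> r \<otimes> b = \<zero>"
proof -
  have "(a \<otimes> r \<otimes> b) \<otimes> (a \<otimes> r \<otimes> b) = a \<otimes> r \<otimes> (b \<otimes> a) \<otimes> (r \<otimes> b)" by (simp add: m_assoc)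
  then show ?thesis using assms mult_zero_commute[of a b] reduced[of "a \<otimes> r \<otimes> b"] by simp
qed

text \<open>Insertion of factors does the work: \<open>c\<close> goes into \<open>a(bc) = 0\<close>,
  then \<open>a\<close> into \<open>(acb)c = 0\<close>. The resulting \<open>(acb)ac = 0\<close>,
  multiplied by \<open>b\<close>, shows that \<open>acb\<close> has square zero.\<close>

sublocale symmetric_ring R
proof
  fix a b c assume c[simp]: "a \<in> carrier R" "b \<in> carrier R" "c \<in> carrier R" and "a \<otimes> b \<otimes> c = \<zero>"
  then have "a \<otimes> (b \<otimes> c) = \<zero>" by (simp add: m_assoc)
  then have "a \<otimes> c \<otimes> (b \<otimes> c) = \<zero>" by (intro mult_zero_insert[of a "b \<otimes> c"]) auto
  then have "(a \<otimes> c \<otimes> b) \<otimes> c = \<zero>" by (simp add: m_assoc)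
  then have "(a \<otimes> c \<otimes> b) \<otimes> a \<otimes> c = \<zero>" by (intro mult_zero_insert[of "a \<otimes> c \<otimes> b"]) auto
  then have "(a \<otimes> c \<otimes> b) \<otimes> (a \<otimes> c \<otimes> b) = \<zero>"
    by (metis c l_null m_assoc m_closed)
  then show "a \<otimes> c \<otimes> b = \<zero>" by (rule reduced[rotated]) simp
qed

text \<open>A truncated form of the Armendariz property of reduced rings. The induction is on the
  total degree and, within degree \<open>m\<close>, on \<open>i\<close>: multiplying the
  degree-\<open>m\<close> equation on the right by \<open>f i\<close> leaves only
  \<open>f i \<otimes> g (m - i) \<otimes> f i\<close>, so \<open>f i \<otimes> g (m - i)\<close>
  squares to zero.\<close>

lemma convolution_zero:
  fixes f g :: "nat \<Rightarrow> 'a"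
  assumes [simp]: "\<And>i. f i \<in> carrier R" "\<And>i. g i \<in> carrier R"
    and conv: "\<And>m. m < n \<Longrightarrow> (\<Oplus>i\<in>{..m}. f i \<otimes> g (m - i)) = \<zero>"
    and "i + j < n"
  shows "f i \<otimes> g j = \<zero>"
  using \<open>i + j < n\<close>
proof (induction "i + j" arbitrary: i j rule: less_induct)
  case less
  define m where "m = i + j"
  have "m < n" using less.prems by (simp add: m_def)
  have lower: "f i' \<otimes> g j' = \<zero>" if "i' + j' < m" for i' j'
    using less that by (auto simp: m_def)
  have "f i \<otimes> g (m - i) = \<zero>" if "i \<le> m" for i
    using that
  proof (induction i rule: less_induct)
    case (less i)
    have "(f i' \<otimes> g (m - i')) \<otimes> f i = \<zero>" if "i' \<le> m" "i' \<noteq> i" for i'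
    proof (cases "i' < i")
      case True
      then show ?thesis using less by simp
    next
      case False
      \<comment> \<open>Here \<open>i < i'\<close>, so \<open>i + (m - i') < m\<close> and the outer
        induction applies.\<close>
      then have "f i \<otimes> g (m - i') = \<zero>" using that by (intro lower) auto
      then have "g (m - i') \<otimes> f i = \<zero>" by (intro mult_zero_commute[of "f i"]) auto
      then show ?thesis by (simp add: m_assoc)
    qed
    then have "(f i \<otimes> g (m - i)) \<otimes> f i = (\<Oplus>i'\<in>{..m}. (f i' \<otimes> g (m - i')) \<otimes> f i)"
      using less.prems by (intro finsum_single[symmetric]) auto
    also have "\<dots> = (\<Oplus>i'\<in>{..m}. f i' \<otimes> g (m - i')) \<otimes> f i"
      by (intro finsum_ldistr[symmetric]) auto
    also have "\<dots> = \<zero>"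
      using conv[OF \<open>m < n\<close>] by simp
    finally have "(f i \<otimes> g (m - i)) \<otimes> f i \<otimes> g (m - i) = \<zero>" by simp
    then show ?case using reduced[of "f i \<otimes> g (m - i)"] by (simp add: m_assoc)
  qed
  from this[of i] show ?case by (simp add: m_def)
qed

text \<open>The maps \<open>c a\<close> behave like the coefficient maps of \<open>A \<cong> R[x]/(x\<^sup>n)\<close>.\<close>

lemma symmetric_ring_of_coefficients:
  fixes n :: nat
  assumes "ring A"
    and closed: "\<And>a p. p \<in> carrier A \<Longrightarrow> c a p \<in> carrier R"
    and mult: "\<And>a p q. a < n \<Longrightarrow> p \<in> carrier A \<Longrightarrow> q \<in> carrier A \<Longrightarrow>
      c a (p \<otimes>\<^bsub>A\<^esub> q) = (\<Oplus>b\<in>{..a}. c b p \<otimes> c (a - b) q)"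
    and zero: "\<And>p. p \<in> carrier A \<Longrightarrow> p = \<zero>\<^bsub>A\<^esub> \<longleftrightarrow> (\<forall>a<n. c a p = \<zero>)"
  shows "symmetric_ring A"
proof -
  interpret A: ring A by fact
  show ?thesis
  proof unfold_locales
    fix p q r assume in_A[simp]: "p \<in> carrier A" "q \<in> carrier A" "r \<in> carrier A"
      and "p \<otimes>\<^bsub>A\<^esub> q \<otimes>\<^bsub>A\<^esub> r = \<zero>\<^bsub>A\<^esub>"
    note [simp] = closed
    have conv: "(\<Oplus>b\<in>{..a}. c b (p \<otimes>\<^bsub>A\<^esub> q) \<otimes> c (a - b) r) = \<zero>" if "a < n" for a
      using zero[of "p \<otimes>\<^bsub>A\<^esub> q \<otimes>\<^bsub>A\<^esub> r"] mult[of a "p \<otimes>\<^bsub>A\<^esub> q" r] that \<open>p \<otimes>\<^bsub>A\<^esub> q \<otimes>\<^bsub>A\<^esub> r = \<zero>\<^bsub>A\<^esub>\<close> by simp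
    \<comment> \<open>The triple product is taken apart in two stages; first \<open>r\<close> is
      separated from the product of \<open>p\<close> and \<open>q\<close>.\<close>
    have pq_r: "c b (p \<otimes>\<^bsub>A\<^esub> q) \<otimes> c k r = \<zero>" if "b + k < n" for b k
      by (rule convolution_zero[where n = n and f = "\<lambda>b. c b (p \<otimes>\<^bsub>A\<^esub> q)" and g = "\<lambda>k. c k r"]) (use conv that in auto)
    \<comment> \<open>With \<open>k\<close> fixed, \<open>p\<close> is now separated from
      \<open>q\<close>. The bound drops to \<open>n - k\<close> because the first stage covers only
      degrees \<open>m\<close> with \<open>m + k < n\<close>.\<close>
    have "c i p \<otimes> (c j q \<otimes> c k r) = \<zero>" if "i + j + k < n" for i j k
    proof (rule convolution_zero[where n = "n - k" and f = "\<lambda>i. c i p" and g = "\<lambda>j. c j q \<otimes> c k r"])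
      fix m assume "m < n - k"
      then have "\<zero> = (\<Oplus>i\<in>{..m}. c i p \<otimes> c (m - i) q) \<otimes> c k r"
        using pq_r[of m k] mult[of m p q] by simp
      also have "\<dots> = (\<Oplus>i\<in>{..m}. c i p \<otimes> c (m - i) q \<otimes> c k r)"
        by (intro finsum_ldistr) auto
      finally show "(\<Oplus>i\<in>{..m}. c i p \<otimes> (c (m - i) q \<otimes> c k r)) = \<zero>" by (simp add: m_assoc)
    qed (use that in auto)
    \<comment> \<open>The coefficients lie in a symmetric ring, so the last two factors may be
      swapped; the condition on the index sum is unaffected.\<close>
    then have prq: "c i p \<otimes> c k r \<otimes> c j q = \<zero>" if "i + k + j < n" for i j k
      using symmetric[of "c i p" "c j q" "c k r"] that by (simp add: m_assoc add_ac)
    have "c a (p \<otimes>\<^bsub>A\<^esub> r) \<otimes> c j q = \<zero>" if "a + j < n" for a j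
    proof -
      have "c a (p \<otimes>\<^bsub>A\<^esub> r) \<otimes> c j q = (\<Oplus>i\<in>{..a}. c i p \<otimes> c (a - i) r \<otimes> c j q)"
        using that mult[of a p r] by (simp add: finsum_ldistr Pi_def)
      also have "\<dots> = (\<Oplus>i\<in>{..a}. \<zero>)" using that by (intro finsum_cong') (auto simp: prq)
      finally show ?thesis by simp
    qed
    then have "c a (p \<otimes>\<^bsub>A\<^esub> r \<otimes>\<^bsub>A\<^esub> q) = \<zero>" if "a < n" for a
      using that mult[of a "p \<otimes>\<^bsub>A\<^esub> r" q] by (simp cong: finsum_cong add: Pi_def)
    then show "p \<otimes>\<^bsub>A\<^esub> r \<otimes>\<^bsub>A\<^esub> q = \<zero>\<^bsub>A\<^esub>" using zero[of "p \<otimes>\<^bsub>A\<^esub> r \<otimes>\<^bsub>A\<^esub> q"] by simp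
  qed
qed

end

subsection \<open>Skew polynomial rings\<close>

text \<open>Serves twice: for \<open>R\<close> with its given endomorphism and for the truncated
  polynomial ring with the induced one. Both skew polynomial rings get their ring laws from
  here.\<close>

locale ring_endo = ring R for R (structure) +
  fixes h
  assumes endo: "h \<in> ring_hom R R"
begin

lemma funpow_endo: "h ^^ i \<in> ring_hom R R"
  by (induction i) (use endo in \<open>auto simp: ring_hom_def Pi_def\<close>)

lemma funpow_closed [simp]: "a \<in> carrier R \<Longrightarrow> (h ^^ i) a \<in> carrier R"
  by (rule ring_hom_closed[OF funpow_endo])

lemma funpow_add_hom [simp]:
  "a \<in> carrier R \<Longrightarrow> b \<in> carrier R \<Longrightarrow> (h ^^ i) (a \<oplus> b) = (h ^^ i) a \<oplus> (h ^^ i) b"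
  by (rule ring_hom_add[OF funpow_endo])

lemma funpow_mult_hom [simp]:
  "a \<in> carrier R \<Longrightarrow> b \<in> carrier R \<Longrightarrow> (h ^^ i) (a \<otimes> b) = (h ^^ i) a \<otimes> (h ^^ i) b"
  by (rule ring_hom_mult[OF funpow_endo])

lemma funpow_one [simp]: "(h ^^ i) \<one> = \<one>"
  by (rule ring_hom_one[OF funpow_endo])

lemma funpow_zero [simp]: "(h ^^ i) \<zero> = \<zero>"
  by (metis funpow_add_hom funpow_closed l_zero r_zero zero_closed add.r_cancel_one')

lemma funpow_finsum:
  "f \<in> A \<rightarrow> carrier R \<Longrightarrow> (h ^^ i) (finsum R f A) = (\<Oplus>x\<in>A. (h ^^ i) (f x))"
  by (induction A rule: infinite_finite_induct) (auto simp: Pi_def)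

abbreviation S where "S \<equiv> skew_poly R h"

lemma skew_poly_simps:
  "carrier S = up R"
  "p \<otimes>\<^bsub>S\<^esub> q = (\<lambda>k. \<Oplus>i\<in>{..k}. p i \<otimes> (h ^^ i) (q (k - i)))"
  "\<one>\<^bsub>S\<^esub> = (\<lambda>i. if i = 0 then \<one> else \<zero>)"
  "\<zero>\<^bsub>S\<^esub> = (\<lambda>i. \<zero>)"
  "p \<oplus>\<^bsub>S\<^esub> q = (\<lambda>i. p i \<oplus> q i)"
  by (simp_all add: skew_poly_def)

lemma skew_poly_mult_closed:
  assumes p: "p \<in> up R" and q: "q \<in> up R"
  shows "p \<otimes>\<^bsub>S\<^esub> q \<in> up R"
proof -
  note [simp] = mem_upD[OF p] mem_upD[OF q]
  obtain m where m: "bound \<zero> m p" using p by blast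
  obtain l where l: "bound \<zero> l q" using q by blast
  \<comment> \<open>For \<open>k > m + l\<close>, every \<open>i\<close> satisfies
    \<open>m < i\<close> or \<open>l < k - i\<close>, and iterates of \<open>h\<close> preserve
    \<open>\<zero>\<close>.\<close>
  have "(\<Oplus>i\<in>{..k}. p i \<otimes> (h ^^ i) (q (k - i))) = \<zero>" if "m + l < k" for k
  proof -
    have "p i \<otimes> (h ^^ i) (q (k - i)) = \<zero>" for i
    proof (cases "m < i")
      case True
      then show ?thesis using bound.bound[OF m] by simp
    next
      case False
      then show ?thesis using bound.bound[OF l, of "k - i"] that by simp
    qed
    then show ?thesis by simp
  qed
  then have "bound \<zero> (m + l) (p \<otimes>\<^bsub>S\<^esub> q)" by (auto simp: skew_poly_simps)
  then show ?thesis by (intro mem_upI) (auto simp: skew_poly_simps)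
qed

lemma skew_poly_assoc:
  assumes p: "p \<in> up R" and q: "q \<in> up R" and r: "r \<in> up R"
  shows "p \<otimes>\<^bsub>S\<^esub> q \<otimes>\<^bsub>S\<^esub> r = p \<otimes>\<^bsub>S\<^esub> (q \<otimes>\<^bsub>S\<^esub> r)"
proof
  fix k
  note [simp] = mem_upD[OF p] mem_upD[OF q] mem_upD[OF r]
  \<comment> \<open>The contribution of \<open>p i\<close>, \<open>q (j - i)\<close> and
    \<open>r (k - j)\<close> to degree \<open>k\<close>, with \<open>j\<close> the degree reached
    after two factors. For the other bracketing \<open>j\<close> is counted from \<open>i\<close>,
    and \<open>h ^^ (i + j)\<close> splits as \<open>h ^^ i\<close> after
    \<open>h ^^ j\<close>.\<close>
  let ?t = "\<lambda>i j. p i \<otimes> (h ^^ i) (q (j - i)) \<otimes> (h ^^ j) (r (k - j))"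
  have "(p \<otimes>\<^bsub>S\<^esub> q \<otimes>\<^bsub>S\<^esub> r) k = (\<Oplus>j\<in>{..k}. \<Oplus>i\<in>{..j}. ?t i j)"
    by (simp add: skew_poly_simps finsum_ldistr Pi_def)
  also have "\<dots> = (\<Oplus>i\<in>{..k}. \<Oplus>j\<in>{..k - i}. ?t i (i + j))"
    by (rule finsum_triangle) simp
  also have "\<dots> = (p \<otimes>\<^bsub>S\<^esub> (q \<otimes>\<^bsub>S\<^esub> r)) k"
    by (simp add: skew_poly_simps finsum_rdistr funpow_finsum Pi_def m_assoc funpow_add)
  finally show "(p \<otimes>\<^bsub>S\<^esub> q \<otimes>\<^bsub>S\<^esub> r) k = (p \<otimes>\<^bsub>S\<^esub> (q \<otimes>\<^bsub>S\<^esub> r)) k" .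
qed

lemma skew_poly_l_one:
  assumes p: "p \<in> up R"
  shows "\<one>\<^bsub>S\<^esub> \<otimes>\<^bsub>S\<^esub> p = p"
proof
  fix k
  note [simp] = mem_upD[OF p]
  show "(\<one>\<^bsub>S\<^esub> \<otimes>\<^bsub>S\<^esub> p) k = p k"
    using finsum_single[of "{..k}" 0 "\<lambda>i. (if i = 0 then \<one> else \<zero>) \<otimes> (h ^^ i) (p (k - i))"]
    by (simp add: skew_poly_simps)
qed

lemma skew_poly_r_one:
  assumes p: "p \<in> up R"
  shows "p \<otimes>\<^bsub>S\<^esub> \<one>\<^bsub>S\<^esub> = p"
proof
  fix k
  note [simp] = mem_upD[OF p]
  show "(p \<otimes>\<^bsub>S\<^esub> \<one>\<^bsub>S\<^esub>) k = p k"
    using finsum_single[of "{..k}" k "\<lambda>i. p i \<otimes> (h ^^ i) (if k - i = 0 then \<one> else \<zero>)"]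
    by (simp add: skew_poly_simps)
qed

lemma ring_skew_poly: "ring S"
proof (rule ringI)
  note [simp] = mem_upD
  show "abelian_group S"
  proof (rule abelian_groupI)
    fix p assume "p \<in> carrier S"
    then have p: "p \<in> up R" by (simp add: skew_poly_simps(1))
    then have "(\<lambda>i. \<ominus> p i) \<in> carrier S" by (simp add: skew_poly_simps(1) up_a_inv_closed)
    moreover have "(\<lambda>i. \<ominus> p i) \<oplus>\<^bsub>S\<^esub> p = \<zero>\<^bsub>S\<^esub>"
      using p by (simp add: skew_poly_simps l_neg)
    ultimately show "\<exists>q\<in>carrier S. q \<oplus>\<^bsub>S\<^esub> p = \<zero>\<^bsub>S\<^esub>" by blast
  next
    show "\<zero>\<^bsub>S\<^esub> \<in> carrier S" by (auto simp: skew_poly_simps)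
  next
    fix p q assume "p \<in> carrier S" "q \<in> carrier S"
    then show "p \<oplus>\<^bsub>S\<^esub> q \<in> carrier S" "p \<oplus>\<^bsub>S\<^esub> q = q \<oplus>\<^bsub>S\<^esub> p"
      by (simp_all add: skew_poly_simps up_add_closed a_comm)
  next
    fix p q r assume "p \<in> carrier S" "q \<in> carrier S" "r \<in> carrier S"
    then show "p \<oplus>\<^bsub>S\<^esub> q \<oplus>\<^bsub>S\<^esub> r = p \<oplus>\<^bsub>S\<^esub> (q \<oplus>\<^bsub>S\<^esub> r)"
      by (simp add: skew_poly_simps a_assoc)
  qed (simp add: skew_poly_simps)
  show "monoid S"
  proof (rule monoidI)
    show "\<one>\<^bsub>S\<^esub> \<in> carrier S" by (simp add: skew_poly_simps up_one_closed)
  qed (simp_all only: skew_poly_mult_closed skew_poly_assoc skew_poly_l_one skew_poly_r_one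
        skew_poly_simps(1))
  fix p q r assume "p \<in> carrier S" "q \<in> carrier S" "r \<in> carrier S"
  then have [simp]: "p i \<in> carrier R" "q i \<in> carrier R" "r i \<in> carrier R" for i
    by (simp_all add: skew_poly_simps(1))
  show "(p \<oplus>\<^bsub>S\<^esub> q) \<otimes>\<^bsub>S\<^esub> r = p \<otimes>\<^bsub>S\<^esub> r \<oplus>\<^bsub>S\<^esub> q \<otimes>\<^bsub>S\<^esub> r"
    by (simp add: skew_poly_simps l_distr finsum_addf Pi_def)
  show "r \<otimes>\<^bsub>S\<^esub> (p \<oplus>\<^bsub>S\<^esub> q) = r \<otimes>\<^bsub>S\<^esub> p \<oplus>\<^bsub>S\<^esub> r \<otimes>\<^bsub>S\<^esub> q"
    by (simp add: skew_poly_simps r_distr finsum_addf Pi_def)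
qed

text \<open>Reduces equations between sums in \<open>S\<close> to equations in \<open>R\<close>, one
  coefficient at a time.\<close>

lemma skew_poly_finsum:
  assumes "\<And>x. x \<in> A \<Longrightarrow> f x \<in> carrier S"
  shows "finsum S f A k = (\<Oplus>x\<in>A. f x k)"
proof -
  interpret S: ring S by (rule ring_skew_poly)
  show ?thesis using assms
  proof (induction A rule: infinite_finite_induct)
    case (insert x A)
    have "f y k \<in> carrier R" if "y \<in> insert x A" for y
      using insert.prems[OF that] by (simp add: skew_poly_simps(1) mem_upD)
    moreover have "finsum S f (insert x A) = f x \<oplus>\<^bsub>S\<^esub> finsum S f A"
      using insert by (intro S.finsum_insert) auto
    ultimately show ?case using insert by (simp add: skew_poly_simps(5))
  qed (simp_all add: skew_poly_simps)
qed

end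

section \<open>Rigid endomorphisms and reducedness\<close>

locale rigid_ring = ring_endo +
  assumes rigid: "rigid R h"
begin

lemma endo_simps [simp]:
  "a \<in> carrier R \<Longrightarrow> h a \<in> carrier R"
  "a \<in> carrier R \<Longrightarrow> b \<in> carrier R \<Longrightarrow> h (a \<otimes> b) = h a \<otimes> h b"
  "h \<zero> = \<zero>"
  using ring_hom_closed[OF endo] ring_hom_mult[OF endo] ring_hom_zero[OF endo ring_axioms ring_axioms]
  by blast+

lemma rigidD: "a \<in> carrier R \<Longrightarrow> a \<otimes> h a = \<zero> \<Longrightarrow> a = \<zero>"
  using rigid unfolding rigid_def by blast

text \<open>Rigidity is applied twice: first to \<open>a \<otimes> h a\<close>, whose product with
  its own image contains \<open>h (a \<otimes> a)\<close>, then to \<open>a\<close> itself.\<close>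

sublocale reduced_ring R
proof
  fix a assume [simp]: "a \<in> carrier R" and "a \<otimes> a = \<zero>"
  have "(a \<otimes> h a) \<otimes> h (a \<otimes> h a) = a \<otimes> h (a \<otimes> a) \<otimes> h (h a)"
    by (simp add: m_assoc)
  also have "\<dots> = \<zero>" by (simp only: \<open>a \<otimes> a = \<zero>\<close>) simp
  finally have "a \<otimes> h a = \<zero>" by (rule rigidD[rotated]) simp
  then show "a = \<zero>" by (rule rigidD[rotated]) simp
qed

text \<open>One application of \<open>h\<close> is stripped at a time: if
  \<open>a \<otimes> h d = \<zero>\<close>, this product sits inside
  \<open>(d \<otimes> a) \<otimes> h (d \<otimes> a)\<close>, so \<open>d \<otimes> a\<close>
  vanishes by rigidity and \<open>a \<otimes> d\<close> by reducedness.\<close>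

lemma mult_funpow_zero:
  assumes [simp]: "a \<in> carrier R" "b \<in> carrier R" and "a \<otimes> (h ^^ i) b = \<zero>"
  shows "a \<otimes> b = \<zero>"
  using assms(3)
proof (induction i)
  case (Suc i)
  define d where "d = (h ^^ i) b"
  have [simp]: "d \<in> carrier R" by (simp add: d_def)
  have "a \<otimes> h d = \<zero>" using Suc.prems by (simp add: d_def)
  have "(d \<otimes> a) \<otimes> h (d \<otimes> a) = d \<otimes> (a \<otimes> h d) \<otimes> h a" by (simp add: m_assoc)
  also have "\<dots> = \<zero>" by (simp add: \<open>a \<otimes> h d = \<zero>\<close>)
  finally have "d \<otimes> a = \<zero>" by (rule rigidD[rotated]) simp
  then have "a \<otimes> d = \<zero>" by (rule mult_zero_commute[rotated 2]) simp_all
  then show ?case using Suc.IH by (simp add: d_def)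
qed simp

text \<open>Once the coefficients below \<open>i\<close> vanish, the coefficient of the square in
  degree \<open>2 * i\<close> is just \<open>p i \<otimes> (h ^^ i) (p i)\<close>, since any other
  summand has a factor of index below \<open>i\<close>.\<close>

lemma reduced_skew_poly: "reduced_ring S"
proof -
  interpret S: ring S by (rule ring_skew_poly)
  show ?thesis
  proof unfold_locales
    fix p assume "p \<in> carrier S" and sq: "p \<otimes>\<^bsub>S\<^esub> p = \<zero>\<^bsub>S\<^esub>"
    then have [simp]: "p i \<in> carrier R" for i by (simp add: skew_poly_simps mem_upD)
    have "p i = \<zero>" for i
    proof (induction i rule: less_induct)
      case (less i)
      have "p j \<otimes> (h ^^ j) (p (2 * i - j)) = \<zero>" if "j \<noteq> i" "j \<le> 2 * i" for j
        using less[of j] less[of "2 * i - j"] that by (cases "j < i") simp_all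
      then have "p i \<otimes> (h ^^ i) (p (2 * i - i)) = (\<Oplus>j\<in>{..2 * i}. p j \<otimes> (h ^^ j) (p (2 * i - j)))"
        by (intro finsum_single[symmetric]) auto
      also have "\<dots> = \<zero>" using fun_cong[OF sq, of "2 * i"] by (simp add: skew_poly_simps)
      finally have "p i \<otimes> (h ^^ i) (p i) = \<zero>" by simp
      then have "p i \<otimes> p i = \<zero>" by (rule mult_funpow_zero[rotated 2]) simp_all
      then show ?case by (rule reduced[rotated]) simp
    qed
    then show "p = \<zero>\<^bsub>S\<^esub>" by (auto simp: skew_poly_simps)
  qed
qed

end

subsection \<open>Coefficients in the truncated polynomial ring\<close>

lemma (in UP_ring) monom_one_pow: "monom P \<one> 1 [^]\<^bsub>P\<^esub> (n :: nat) = monom P \<one> n"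
proof (induction n)
  case (Suc n)
  then show ?case by (simp only: P.nat_pow_Suc monom_one_Suc[of n])
qed simp

context ring
begin

interpretation UP: UP_ring R "UP R" by unfold_locales

text \<open>Minimality of the generated ideal gives one inclusion. For the other, a polynomial
  without terms below degree \<open>n\<close> is divided by \<open>x^n\<close>.\<close>

lemma x_power_ideal_eq:
  "x_power_ideal R n = {p \<in> carrier (UP R). \<forall>a<n. coeff (UP R) p a = \<zero>}" (is "_ = ?J")
proof
  interpret I: ideal "x_power_ideal R n" "UP R" by (rule x_power_ideal) (rule ring_axioms)
  show "x_power_ideal R n \<subseteq> ?J"
    unfolding x_power_ideal_def UP.monom_one_pow
  proof (rule UP.P.genideal_minimal)
    show "ideal ?J (UP R)"
    proof (rule idealI[OF UP.P.ring_axioms])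
      show "subgroup ?J (add_monoid (UP R))"
        by (rule UP.P.add.subgroupI) auto
    qed (auto simp: Pi_def cong: finsum_cong)
  qed auto
  show "?J \<subseteq> x_power_ideal R n"
  proof
    fix p assume p: "p \<in> ?J"
    \<comment> \<open>The quotient of \<open>p\<close> by \<open>x^n\<close>: its coefficients
      shifted down by \<open>n\<close>.\<close>
    define q where "q = (\<lambda>i. p (i + n))"
    have "p \<in> up R" using p by (simp add: UP_def)
    then obtain m where "bound \<zero> m p" by blast
    then have "bound \<zero> m q" using bound.bound[of \<zero> m p] by (auto simp: q_def)
    then have "q \<in> up R" using \<open>p \<in> up R\<close> by (intro mem_upI) (auto simp: q_def)
    then have [simp]: "q \<in> carrier (UP R)" by (simp add: UP_def)
    have coeff_q: "coeff (UP R) q i = coeff (UP R) p (i + n)" for i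
      using \<open>p \<in> up R\<close> \<open>q \<in> up R\<close> by (simp add: UP_def q_def)
    have "coeff (UP R) (q \<otimes>\<^bsub>UP R\<^esub> monom (UP R) \<one> n) k = coeff (UP R) p k" for k
    proof (cases "n \<le> k")
      case True
      then show ?thesis
        using p finsum_single[of "{..k}" "k - n" "\<lambda>i. coeff (UP R) q i \<otimes> (if n = k - i then \<one> else \<zero>)"]
        by (auto simp: coeff_q)
    next
      case False
      then have "(\<Oplus>i\<in>{..k}. coeff (UP R) q i \<otimes> (if n = k - i then \<one> else \<zero>)) = (\<Oplus>i\<in>{..k}. \<zero>)"
        by (intro finsum_cong') auto
      then show ?thesis using False p by simp
    qed
    then have "p = q \<otimes>\<^bsub>UP R\<^esub> monom (UP R) \<one> n"
      using p by (intro UP.up_eqI) auto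
    moreover have "monom (UP R) \<one> n \<in> x_power_ideal R n"
      using UP.P.genideal_self'[of "monom (UP R) \<one> n"] unfolding x_power_ideal_def UP.monom_one_pow by simp
    ultimately show "p \<in> x_power_ideal R n" using I.I_l_closed by simp
  qed
qed

end

text \<open>
  For \<open>a < n\<close> every representative of a coset has the same coefficient. The value \<open>\<zero>\<close> for
  \<open>a \<ge> n\<close> makes the map additive for all \<open>a\<close>.
\<close>

definition trunc_coeff :: "('a, 'm) ring_scheme \<Rightarrow> nat \<Rightarrow> nat \<Rightarrow> (nat \<Rightarrow> 'a) set \<Rightarrow> 'a" where
  "trunc_coeff R n a C = (if a < n then coeff (UP R) (SOME p. p \<in> C) a else \<zero>\<^bsub>R\<^esub>)"

context ring_endo
begin

interpretation UP: UP_ring R "UP R" by unfold_locales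

context
  fixes n :: nat
begin

abbreviation I where "I \<equiv> x_power_ideal R n"
abbreviation T where "T \<equiv> trunc_poly R n"
abbreviation \<tau> where "\<tau> \<equiv> induced_endo R n h"
abbreviation c where "c \<equiv> trunc_coeff R n"

interpretation I: ideal I "UP R" by (rule x_power_ideal) (rule ring_axioms)

lemma ring_trunc_poly: "ring T"
  unfolding trunc_poly_def by (rule I.quotient_is_ring)

lemma coset_hom: "(+>\<^bsub>UP R\<^esub>) I \<in> ring_hom (UP R) T"
  unfolding trunc_poly_def by (rule I.rcos_ring_hom)

lemma trunc_polyE:
  assumes "x \<in> carrier T"
  obtains p where "p \<in> carrier (UP R)" "x = I +>\<^bsub>UP R\<^esub> p"
  using assms unfolding trunc_poly_def FactRing_def A_RCOSETS_def' by auto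

lemma trunc_coeff_coset:
  assumes p: "p \<in> carrier (UP R)" and "a < n"
  shows "c a (I +>\<^bsub>UP R\<^esub> p) = coeff (UP R) p a"
proof -
  define r where "r = (SOME q. q \<in> I +>\<^bsub>UP R\<^esub> p)"
  have "r \<in> I +>\<^bsub>UP R\<^esub> p"
    unfolding r_def using I.a_rcos_self[OF p] by (rule someI[of "\<lambda>q. q \<in> I +>\<^bsub>UP R\<^esub> p"])
  then obtain q where "q \<in> I" "r = q \<oplus>\<^bsub>UP R\<^esub> p"
    unfolding a_r_coset_def' by blast
  moreover from \<open>q \<in> I\<close> have "q \<in> carrier (UP R)" "coeff (UP R) q a = \<zero>"
    using \<open>a < n\<close> unfolding x_power_ideal_eq by blast+
  moreover have "c a (I +>\<^bsub>UP R\<^esub> p) = coeff (UP R) r a"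
    using \<open>a < n\<close> unfolding trunc_coeff_def r_def by simp
  ultimately show ?thesis using p by simp
qed

lemma trunc_coeff_closed [simp]:
  assumes "x \<in> carrier T"
  shows "c a x \<in> carrier R"
proof (cases "a < n")
  case True
  with assms show ?thesis by (elim trunc_polyE) (simp add: trunc_coeff_coset)
qed (simp add: trunc_coeff_def)

text \<open>A coset is zero exactly when its representative lies in the ideal, which is a condition
  on the coefficients below \<open>n\<close>.\<close>

lemma trunc_coeff_eq_zero: "x \<in> carrier T \<Longrightarrow> x = \<zero>\<^bsub>T\<^esub> \<longleftrightarrow> (\<forall>a<n. c a x = \<zero>)"
proof (erule trunc_polyE)
  fix p assume p: "p \<in> carrier (UP R)" and x: "x = I +>\<^bsub>UP R\<^esub> p"
  have "x = \<zero>\<^bsub>T\<^esub> \<longleftrightarrow> p \<in> I"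
  proof
    assume "x = \<zero>\<^bsub>T\<^esub>"
    then have "I +>\<^bsub>UP R\<^esub> p = I" by (simp add: x trunc_poly_def FactRing_def)
    then show "p \<in> I" using I.a_rcos_self[OF p] by simp
  next
    assume "p \<in> I"
    then have "I +>\<^bsub>UP R\<^esub> p = I" by (rule I.a_rcos_const)
    then show "x = \<zero>\<^bsub>T\<^esub>" by (simp add: x trunc_poly_def FactRing_def)
  qed
  also have "\<dots> \<longleftrightarrow> (\<forall>a<n. coeff (UP R) p a = \<zero>)"
    unfolding x_power_ideal_eq using p by blast
  also have "\<dots> \<longleftrightarrow> (\<forall>a<n. c a x = \<zero>)"
    using p by (simp add: x trunc_coeff_coset)
  finally show "x = \<zero>\<^bsub>T\<^esub> \<longleftrightarrow> (\<forall>a<n. c a x = \<zero>)" .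
qed

lemma trunc_coeff_zero [simp]: "c a \<zero>\<^bsub>T\<^esub> = \<zero>"
proof -
  interpret T: ring T by (rule ring_trunc_poly)
  show ?thesis using trunc_coeff_eq_zero[of "\<zero>\<^bsub>T\<^esub>"] by (cases "a < n") (simp_all add: trunc_coeff_def)
qed

lemma trunc_coeff_add:
  assumes "x \<in> carrier T" "y \<in> carrier T"
  shows "c a (x \<oplus>\<^bsub>T\<^esub> y) = c a x \<oplus> c a y"
proof (cases "a < n")
  case True
  with assms show ?thesis
    by (elim trunc_polyE) (simp add: trunc_coeff_coset flip: ring_hom_add[OF coset_hom])
qed (simp add: trunc_coeff_def)

lemma trunc_coeff_mult:
  assumes "a < n" "x \<in> carrier T" "y \<in> carrier T"
  shows "c a (x \<otimes>\<^bsub>T\<^esub> y) = (\<Oplus>b\<in>{..a}. c b x \<otimes> c (a - b) y)"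
proof -
  obtain p q where pq [simp]: "p \<in> carrier (UP R)" "q \<in> carrier (UP R)"
    and xy: "x = I +>\<^bsub>UP R\<^esub> p" "y = I +>\<^bsub>UP R\<^esub> q"
    using assms(2,3) by (meson trunc_polyE)
  have "c a (x \<otimes>\<^bsub>T\<^esub> y) = (\<Oplus>b\<in>{..a}. coeff (UP R) p b \<otimes> coeff (UP R) q (a - b))"
    using \<open>a < n\<close> by (simp add: xy trunc_coeff_coset flip: ring_hom_mult[OF coset_hom])
  also have "\<dots> = (\<Oplus>b\<in>{..a}. c b x \<otimes> c (a - b) y)"
    using assms by (intro finsum_cong') (auto simp: xy trunc_coeff_coset)
  finally show ?thesis .
qed

lemma trunc_coeff_finsum:
  assumes "f \<in> A \<rightarrow> carrier T"
  shows "c a (finsum T f A) = (\<Oplus>x\<in>A. c a (f x))"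
proof -
  interpret T: ring T by (rule ring_trunc_poly)
  show ?thesis using assms
    by (induction A rule: infinite_finite_induct) (auto simp: Pi_def trunc_coeff_add)
qed

section \<open>The induced endomorphism\<close>

lemma coeff_coeff_map:
  assumes "p \<in> carrier (UP R)"
  shows "coeff (UP R) (coeff_map R h p) a = h (coeff (UP R) p a)"
proof -
  \<comment> \<open>\<open>coeff\<close> is specified only on \<open>up R\<close>, so membership has
    to come first.\<close>
  have "coeff_map R h p \<in> up R"
    using ring_hom_closed[OF coeff_map_hom[OF ring_axioms endo] assms] by (simp add: UP_def)
  then have "coeff (UP R) (coeff_map R h p) a = coeff_map R h p a" by (simp add: UP_def)
  then show ?thesis by (simp add: coeff_map_def)
qed

lemma induced_endo_hom: "\<tau> \<in> ring_hom T T"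
proof (rule ring_hom_memI)
  note [simp] = induced_endo_coset[OF ring_axioms endo] ring_hom_closed[OF coset_hom]
    ring_hom_closed[OF coeff_map_hom[OF ring_axioms endo]]
  \<comment> \<open>The coset rules are reversed so that operations on cosets move to
    representatives, where \<open>coeff_map\<close> is a homomorphism.\<close>
  note [simp] = ring_hom_mult[OF coset_hom, symmetric] ring_hom_add[OF coset_hom, symmetric]
    ring_hom_one[OF coset_hom, symmetric]
    ring_hom_mult[OF coeff_map_hom[OF ring_axioms endo]]
    ring_hom_add[OF coeff_map_hom[OF ring_axioms endo]]
    ring_hom_one[OF coeff_map_hom[OF ring_axioms endo]]
  show "\<tau> \<one>\<^bsub>T\<^esub> = \<one>\<^bsub>T\<^esub>" by simp
  fix x y assume x: "x \<in> carrier T"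
  then show "\<tau> x \<in> carrier T" by (auto elim!: trunc_polyE)
  assume "y \<in> carrier T"
  with x show "\<tau> (x \<otimes>\<^bsub>T\<^esub> y) = \<tau> x \<otimes>\<^bsub>T\<^esub> \<tau> y" "\<tau> (x \<oplus>\<^bsub>T\<^esub> y) = \<tau> x \<oplus>\<^bsub>T\<^esub> \<tau> y"
    by (auto elim!: trunc_polyE)
qed

section \<open>Skew polynomials over the truncated ring\<close>

interpretation T: ring_endo T \<tau>
  by (rule ring_endo.intro[OF ring_trunc_poly ring_endo_axioms.intro[OF induced_endo_hom]])

text \<open>On representatives, \<open>\<tau>\<close> applies \<open>h\<close> to each coefficient.
  Iterates are needed because moving \<open>y^i\<close> past a coefficient applies
  \<open>\<tau> ^^ i\<close>.\<close>

lemma trunc_coeff_induced_endo: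
  assumes "x \<in> carrier T" "a < n"
  shows "c a ((\<tau> ^^ i) x) = (h ^^ i) (c a x)"
proof (induction i)
  case (Suc i)
  have "c a (\<tau> y) = h (c a y)" if "y \<in> carrier T" for y
    using that \<open>a < n\<close>
    by (auto elim!: trunc_polyE simp: induced_endo_coset[OF ring_axioms endo] trunc_coeff_coset
        ring_hom_closed[OF coeff_map_hom[OF ring_axioms endo]] coeff_coeff_map)
  then show ?case using Suc assms by simp
qed simp

text \<open>The sequence is the coefficient of \<open>x^a\<close> in \<open>p\<close>, read as a
  polynomial in \<open>y\<close>. Finite support survives because \<open>c a\<close> sends zero to
  zero.\<close>

lemma trunc_coeff_skew_poly:
  assumes "p \<in> carrier (skew_poly T \<tau>)"
  shows "(\<lambda>k. c a (p k)) \<in> carrier S"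
proof -
  have p: "p \<in> up T" using assms by (simp add: T.skew_poly_simps)
  then obtain m where "bound \<zero>\<^bsub>T\<^esub> m p" by blast
  then have "bound \<zero> m (\<lambda>k. c a (p k))" by (auto simp: bound_def)
  then show ?thesis using mem_upD[OF p] by (auto simp: skew_poly_simps(1) intro!: mem_upI)
qed

text \<open>This is where \<open>x\<close> and \<open>y\<close> commute: the coefficient of
  \<open>x^a y^k\<close> is a double sum over the \<open>y\<close>-degree \<open>i\<close> and the
  \<open>x\<close>-degree \<open>b\<close> of the first factor, and exchanging the sums turns it
  into a convolution in \<open>S\<close>.\<close>

lemma trunc_coeff_skew_poly_mult:
  assumes "p \<in> carrier (skew_poly T \<tau>)" "q \<in> carrier (skew_poly T \<tau>)" "a < n"
  shows "(\<lambda>k. c a ((p \<otimes>\<^bsub>skew_poly T \<tau>\<^esub> q) k))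
    = (\<Oplus>\<^bsub>S\<^esub>b\<in>{..a}. (\<lambda>k. c b (p k)) \<otimes>\<^bsub>S\<^esub> (\<lambda>k. c (a - b) (q k)))"
proof
  fix k
  interpret S: ring S by (rule ring_skew_poly)
  have p [simp]: "p i \<in> carrier T" and q [simp]: "q i \<in> carrier T" for i
    using assms by (simp_all add: T.skew_poly_simps mem_upD)
  note [simp] = trunc_coeff_skew_poly[OF assms(1)] trunc_coeff_skew_poly[OF assms(2)]
  have "c a ((p \<otimes>\<^bsub>skew_poly T \<tau>\<^esub> q) k)
      = (\<Oplus>i\<in>{..k}. c a (p i \<otimes>\<^bsub>T\<^esub> (\<tau> ^^ i) (q (k - i))))"
    by (simp add: T.skew_poly_simps trunc_coeff_finsum Pi_def)
  also have "\<dots> = (\<Oplus>i\<in>{..k}. \<Oplus>b\<in>{..a}. c b (p i) \<otimes> (h ^^ i) (c (a - b) (q (k - i))))"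
    using \<open>a < n\<close>
    by (simp add: trunc_coeff_mult trunc_coeff_induced_endo Pi_def cong: finsum_cong)
  also have "\<dots> = (\<Oplus>b\<in>{..a}. \<Oplus>i\<in>{..k}. c b (p i) \<otimes> (h ^^ i) (c (a - b) (q (k - i))))"
    by (rule finsum_swap) simp
  also have "\<dots> = (\<Oplus>b\<in>{..a}. ((\<lambda>k. c b (p k)) \<otimes>\<^bsub>S\<^esub> (\<lambda>k. c (a - b) (q k))) k)"
    by (simp add: skew_poly_simps)
  also have "\<dots> = (\<Oplus>\<^bsub>S\<^esub>b\<in>{..a}. (\<lambda>k. c b (p k)) \<otimes>\<^bsub>S\<^esub> (\<lambda>k. c (a - b) (q k))) k"
    by (rule skew_poly_finsum[symmetric]) simp
  finally show "c a ((p \<otimes>\<^bsub>skew_poly T \<tau>\<^esub> q) k)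
    = (\<Oplus>\<^bsub>S\<^esub>b\<in>{..a}. (\<lambda>k. c b (p k)) \<otimes>\<^bsub>S\<^esub> (\<lambda>k. c (a - b) (q k))) k" .
qed

lemma trunc_coeff_skew_poly_eq_zero:
  assumes "p \<in> carrier (skew_poly T \<tau>)"
  shows "p = \<zero>\<^bsub>skew_poly T \<tau>\<^esub> \<longleftrightarrow> (\<forall>a<n. (\<lambda>k. c a (p k)) = \<zero>\<^bsub>S\<^esub>)"
proof -
  have "p i \<in> carrier T" for i
    using assms by (simp add: T.skew_poly_simps mem_upD)
  then show ?thesis
    by (auto simp: T.skew_poly_simps skew_poly_simps fun_eq_iff trunc_coeff_eq_zero)
qed

text \<open>The maps sending \<open>p\<close> to \<open>\<lambda>k. c a (p k)\<close> make
  \<open>skew_poly T \<tau>\<close> behave like \<open>S[x]/(x^n)\<close>, so the criterion for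
  rings with coefficients in a reduced ring applies over \<open>S\<close>.\<close>

lemma strongly_symmetric_trunc_poly:
  assumes "reduced_ring S"
  shows "strongly_symmetric T \<tau>"
  unfolding strongly_symmetric_def
  by (rule reduced_ring.symmetric_ring_of_coefficients[OF assms T.ring_skew_poly
        trunc_coeff_skew_poly trunc_coeff_skew_poly_mult trunc_coeff_skew_poly_eq_zero])

end

end

theorem corollary3p18:
  fixes R :: "('a, 'm) ring_scheme" and \<sigma> :: "'a \<Rightarrow> 'a" and n :: nat
  assumes "ring R"
    and "\<sigma> \<in> ring_hom R R"
    and "\<exists>a\<in>carrier R. \<sigma> a \<noteq> \<zero>\<^bsub>R\<^esub>"
    and "\<exists>a\<in>carrier R. \<sigma> a \<noteq> a"
    and "n > 0"
    and "rigid R \<sigma>"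
  shows "strongly_symmetric (trunc_poly R n) (induced_endo R n \<sigma>)"
proof -
  interpret ring R by fact
  interpret rigid_ring R \<sigma> by unfold_locales fact+
  show ?thesis by (rule strongly_symmetric_trunc_poly[OF reduced_skew_poly])
qed

end
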